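(* Let $m \geq 1$ be an integer, and consider the $G/G/m$ queue (first-come, first-served, infinite buffer, $m$ parallel servers, starting operation at time zero) with given interarrival times $\alpha_k \geq 0$ and service times $\tau_k > 0$, $k = 1, 2, \ldots$. Let $A_k$, $C_k$ and $D_k$ denote respectively the $k$th arrival epoch, the completion time of the $k$th customer to arrive, and the $k$th departure epoch, with $A_k = D_k = 0$ for all $k \leq 0$. Then the dynamics of the queue is defined by the following recursive equations; that is, $\{A_k\}_{k\ge 1}$, $\{C_k\}_{k\ge 1}$, $\{D_k\}_{k\ge 1}$ are the sequences determined, from the initial values $A_k = D_k = 0$ ($k \leq 0$), by $$ A_k = A_{k-1} + \alpha_k, $$ $$ C_k = (A_k \vee D_{k-m}) + \tau_k, $$ $$ D_k = \left( \bigwedge_{1 \leq j_1 < \cdots < j_k \leq k+m-2} (C_{j_1} \vee \cdots \vee C_{j_k}) \right) \wedge C_{k+m-1}, $$ for each $k = 1, 2, \ldots$.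
   Context: Notation: $\vee$ denotes maximum and $\wedge$ denotes minimum of real numbers. $\bigwedge_{1 \leq j_1 < \cdots < j_k \leq N}$ is the minimum over all strictly increasing $k$-tuples of indices from $\{1,\ldots,N\}$; a minimum over an empty set of tuples (which occurs when $N<k$, i.e. when $m=1$ and $N = k+m-2$) is $+\infty$, so that term is then omitted. The $G/G/m$ queue: the system has an infinite buffer and $m$ ($1 \leq m < \infty$) servers operating in parallel, and starts operating at time zero. Customers are numbered $1,2,\ldots$ in order of arrival. The real numbers $\alpha_k \geq 0$ (interarrival time between customer $k$ and his predecessor; the first customer arrives at time $\alpha_1$) and $\tau_k > 0$ (service time of customer $k$) are given. Customer $k$ arrives at time $A_k = \alpha_1 + \cdots + \alpha_k$. An arriving customer occupies any one of the servers that are not busy; if there are no free servers, he waits in the buffer. His service begins as soon as any one of the servers is unoccupied, provided that all his predecessors have left the buffer (i.e. have begun service). Customers leave the system immediately upon completion of service, and the server becomes free at that moment. Precisely, the service initiation time $S_k$ of customer $k$ and his completion time $C_k$ are given by: $S_k$ is the smallest time $t$ such that $t \geq A_k$, $t \geq S_{k-1}$ (if $k \geq 2$), and at most $m-1$ of the predecessors $j \in \{1,\ldots,k-1\}$ have $C_j > t$; and $C_k = S_k + \tau_k$. The departure epochs $\{D_k\}_{k \geq 1}$ are the completion times $\{C_k\}_{k \geq 1}$ arranged in ascending order: $D_k$ is the $k$th smallest element of $\{C_j\}_{j \geq 1}$, counted with multiplicity, i.e. the smallest real $t$ such that $C_j \leq t$ for at least $k$ indices $j \geq 1$. By convention $A_k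 = 0$ and $D_k = 0$ for all $k \leq 0$. *)

theory Defs
  imports Complex_Main "HOL-Library.Extended_Real"
begin

definition arrival :: "(nat \<Rightarrow> real) \<Rightarrow> int \<Rightarrow> real" where
  "arrival \<alpha> k = (\<Sum>i = 1..nat k. \<alpha> i)"

context
  notes conj_cong [fundef_cong] imp_cong [fundef_cong]
begin

text \<open>
  Customers are numbered from 1; the value at index 0 is irrelevant. The summand
  \<open>service_start m \<alpha> \<tau> j + \<tau> j\<close> is the completion time of customer \<open>j\<close>.
\<close>

function service_start ::
  "nat \<Rightarrow> (nat \<Rightarrow> real) \<Rightarrow> (nat \<Rightarrow> real) \<Rightarrow> nat \<Rightarrow> real" where
  "service_start m \<alpha> \<tau> k =
     (LEAST t. arrival \<alpha> (int k) \<le> t \<and>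
        (2 \<le> k \<longrightarrow> service_start m \<alpha> \<tau> (k - 1) \<le> t) \<and>
        card {j. j \<in> {1..<k} \<and> service_start m \<alpha> \<tau> j + \<tau> j > t} \<le> m - 1)"
  by pat_completeness auto
termination by (relation "measure (\<lambda>(m, \<alpha>, \<tau>, k). k)") auto

end

declare service_start.simps [simp del]

definition completion ::
  "nat \<Rightarrow> (nat \<Rightarrow> real) \<Rightarrow> (nat \<Rightarrow> real) \<Rightarrow> nat \<Rightarrow> real" where
  "completion m \<alpha> \<tau> k = service_start m \<alpha> \<tau> k + \<tau> k"

text \<open>
  Infinitely many customers may have completed by time \<open>t\<close> (e.g. when the service
  times are summable), so ``at least \<open>k\<close> indices'' is expressed by a finite set
  of \<open>k\<close> indices rather than by the cardinality of the set of all such indices.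
\<close>

definition departure ::
  "nat \<Rightarrow> (nat \<Rightarrow> real) \<Rightarrow> (nat \<Rightarrow> real) \<Rightarrow> int \<Rightarrow> real" where
  "departure m \<alpha> \<tau> k =
     (if k \<le> 0 then 0
      else (LEAST t. \<exists>J \<subseteq> {j. 1 \<le> j \<and> completion m \<alpha> \<tau> j \<le> t}.
              finite J \<and> card J = nat k))"

definition increasing_tuples :: "nat \<Rightarrow> nat \<Rightarrow> nat list set" where
  "increasing_tuples k N = {js. length js = k \<and> sorted_wrt (<) js \<and> set js \<subseteq> {1..N}}"

text \<open>
  The minimum over tuples is taken in the extended reals, where the infimum over
  the empty set is \<open>\<infinity>\<close>; this occurs exactly when \<open>m = 1\<close>. All nonempty
  instances are minima over finite sets of reals. The index \<open>k + m - 2\<close> is a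
  natural number because \<open>k\<close> and \<open>m\<close> are at least 1.
\<close>

definition queue_recursion ::
  "nat \<Rightarrow> (nat \<Rightarrow> real) \<Rightarrow> (nat \<Rightarrow> real) \<Rightarrow>
   (int \<Rightarrow> real) \<Rightarrow> (nat \<Rightarrow> real) \<Rightarrow> (int \<Rightarrow> real) \<Rightarrow> bool" where
  "queue_recursion m \<alpha> \<tau> A C D \<longleftrightarrow>
     (\<forall>k\<le>0. A k = 0 \<and> D k = 0) \<and>
     (\<forall>k\<ge>1.
        A (int k) = A (int k - 1) + \<alpha> k \<and>
        C k = max (A (int k)) (D (int k - int m)) + \<tau> k \<and>
        ereal (D (int k)) =
          min (INF js \<in> increasing_tuples k (k + m - 2). ereal (Max (C ` set js)))
              (ereal (C (k + m - 1))))"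

end

theory Submission
  imports Defs
begin

text \<open>
  A real number \<open>d\<close> is determined by the set of all \<open>t\<close> with \<open>d \<le> t\<close>, and for every epoch of the
  queue this set is described by counting completions. Customer \<open>k\<close> has begun service by time
  \<open>t\<close> exactly when he has arrived and at least \<open>k - m\<close> of his \<open>k - 1\<close> predecessors are
  finished (\<open>start_le_iff\<close>); the requirement that his immediate predecessor has
  begun is implied, because with \<open>k - m\<close> of the first \<open>k - 1\<close> customers finished, at least
  \<open>k - m - 1\<close> of the first \<open>k - 2\<close> are.

  The \<open>k\<close>th departure epoch refers to infinitely many customers, but a customer numbered
  \<open>k + m\<close> or later cannot begin, let alone finish, before \<open>k\<close> of the first \<open>k + m - 1\<close>
  customers are finished. Hence at least \<open>k\<close> departures have taken place by time \<open>t\<close> exactly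
  when \<open>k\<close> of the first \<open>k + m - 1\<close> customers are finished (\<open>departure_le_iff\<close>).
  Comparing the two descriptions gives \<open>S k = max (A k) (D (k - m))\<close>.

  The same count gives the formula for \<open>D k\<close>. If customer \<open>k + m - 1\<close> is finished at \<open>t\<close>, then
  he has begun, so \<open>k - 1\<close> earlier customers are finished, and with him that makes \<open>k\<close>. If he is not
  finished, the \<open>k\<close> finished customers are among the first \<open>k + m - 2\<close>, where they form an
  increasing tuple. So his completion time enters the minimum by itself, without a maximum.

  The recursion has only one solution because it can be evaluated in order: \<open>C k\<close> needs
  \<open>D (k - m)\<close>, which needs only \<open>C 1, \<dots>, C (k - 1)\<close>.
\<close>

section \<open>Order statistics and minima over increasing tuples\<close>

lemma Least_eq_if_iff_ge:
  fixes d :: real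
  assumes "\<And>t. P t \<longleftrightarrow> d \<le> t"
  shows "(LEAST t. P t) = d"
  using assms by (intro Least_equality) auto

lemma ereal_eq_if_le_iff:
  assumes "\<And>t. x \<le> ereal t \<longleftrightarrow> d \<le> t"
  shows "ereal d = x"
proof (rule antisym)
  show "x \<le> ereal d" using assms by simp
  show "ereal d \<le> x"
  proof (rule ccontr)
    assume "\<not> ereal d \<le> x"
    then obtain t where "x < ereal t" "ereal t < ereal d"
      using ereal_dense2[of x "ereal d"] by (metis not_le)
    then show False using assms[of t] by simp
  qed
qed

text \<open>
  The number \<open>d\<close> is the \<open>k\<close>th smallest value of \<open>f\<close> on \<open>I\<close>. Its existence is what makes the least
  elements in the definitions of service starts and departures exist.
\<close>

lemma ex_kth_smallest:
  fixes f :: "'a \<Rightarrow> real"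
  assumes "finite I" "1 \<le> k" "k \<le> card I"
  obtains d where "\<And>t. k \<le> card {j \<in> I. f j \<le> t} \<longleftrightarrow> d \<le> t"
proof -
  define T where "T = {t \<in> f ` I. k \<le> card {j \<in> I. f j \<le> t}}"
  have fin: "finite T" using assms(1) by (simp add: T_def)
  have lower: "\<exists>u\<in>T. u \<le> s" if s: "k \<le> card {j \<in> I. f j \<le> s}" for s
  proof -
    let ?J = "{j \<in> I. f j \<le> s}"
    have "?J \<noteq> {}" using s assms(2) by (metis card.empty not_one_le_zero le_trans)
    moreover have finJ: "finite ?J" using assms(1) by simp
    ultimately have "Max (f ` ?J) \<in> f ` ?J" by (intro Max_in) auto
    then obtain i where i: "i \<in> I" "f i \<le> s" "Max (f ` ?J) = f i" by auto
    have "f j \<le> f i" if "j \<in> ?J" for j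
      using that finJ i(3) Max_ge[of "f ` ?J" "f j"] by auto
    then have "?J \<subseteq> {j \<in> I. f j \<le> f i}" by auto
    then have "k \<le> card {j \<in> I. f j \<le> f i}"
      using s assms(1) card_mono[of "{j \<in> I. f j \<le> f i}" ?J] by simp
    then show ?thesis using i by (auto simp: T_def)
  qed
  have "{j \<in> I. f j \<le> Max (f ` I)} = I" using assms(1) by auto
  then have "T \<noteq> {}" using lower[of "Max (f ` I)"] assms(3) by auto
  then have MinT: "Min T \<in> T" using fin by simp
  have "k \<le> card {j \<in> I. f j \<le> t} \<longleftrightarrow> Min T \<le> t" for t
  proof
    assume "k \<le> card {j \<in> I. f j \<le> t}"
    then obtain u where "u \<in> T" "u \<le> t" using lower by blast
    then show "Min T \<le> t" using fin Min_le[of T u] by linarith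
  next
    assume "Min T \<le> t"
    then have "card {j \<in> I. f j \<le> Min T} \<le> card {j \<in> I. f j \<le> t}"
      using assms(1) by (intro card_mono) auto
    then show "k \<le> card {j \<in> I. f j \<le> t}" using MinT by (simp add: T_def)
  qed
  then show ?thesis using that by blast
qed

lemma finite_increasing_tuples: "finite (increasing_tuples k N)"
proof -
  have "increasing_tuples k N \<subseteq> {js. set js \<subseteq> {1..N} \<and> length js = k}"
    by (auto simp: increasing_tuples_def)
  then show ?thesis using finite_lists_length_eq[of "{1..N}" k] finite_subset by blast
qed

lemma ex_increasing_tuple_iff:
  "(\<exists>js \<in> increasing_tuples k N. \<forall>j \<in> set js. P j) \<longleftrightarrow> k \<le> card {j \<in> {1..N}. P j}"
proof
  assume "\<exists>js \<in> increasing_tuples k N. \<forall>j \<in> set js. P j"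
  then obtain js where js: "length js = k" "sorted_wrt (<) js" "set js \<subseteq> {j \<in> {1..N}. P j}"
    unfolding increasing_tuples_def by blast
  then have "card (set js) = k" by (simp add: distinct_card strict_sorted_iff)
  then show "k \<le> card {j \<in> {1..N}. P j}" using js(3) card_mono[of "{j \<in> {1..N}. P j}" "set js"] by simp
next
  assume "k \<le> card {j \<in> {1..N}. P j}"
  then obtain J where J: "J \<subseteq> {j \<in> {1..N}. P j}" "card J = k" "finite J"
    using obtain_subset_with_card_n by metis
  then show "\<exists>js \<in> increasing_tuples k N. \<forall>j \<in> set js. P j"
    by (intro bexI[of _ "sorted_list_of_set J"]) (auto simp: increasing_tuples_def)
qed

text \<open>
  The case \<open>x = \<infinity>\<close> has to be excluded because the infimum over the empty set is \<open>\<infinity>\<close>.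
\<close>

lemma INF_finite_le_iff:
  fixes f :: "'a \<Rightarrow> ereal"
  assumes "finite I" "x \<noteq> \<infinity>"
  shows "(INF i \<in> I. f i) \<le> x \<longleftrightarrow> (\<exists>i \<in> I. f i \<le> x)"
proof (cases "I = {}")
  case True
  then show ?thesis using assms(2) by (simp add: top_ereal_def)
next
  case False
  then have "(INF i \<in> I. f i) = Min (f ` I)" using assms(1) by (simp add: Min_Inf)
  then show ?thesis using False assms(1) by (simp add: Min_le_iff)
qed

section \<open>Service starts and departures by counting completions\<close>

lemma arrival_Suc: "arrival \<alpha> (int (Suc k)) = arrival \<alpha> (int k) + \<alpha> (Suc k)"
  by (simp add: arrival_def nat_add_distrib)

locale multi_server_queue =
  fixes m :: nat and \<alpha> \<tau> :: "nat \<Rightarrow> real"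
  assumes servers: "m \<ge> 1"
    and interarrival_nonneg: "\<And>k. k \<ge> 1 \<Longrightarrow> \<alpha> k \<ge> 0"
    and service_pos: "\<And>k. k \<ge> 1 \<Longrightarrow> \<tau> k > 0"
begin

abbreviation "S \<equiv> service_start m \<alpha> \<tau>"
abbreviation "C \<equiv> completion m \<alpha> \<tau>"
abbreviation "D \<equiv> departure m \<alpha> \<tau>"

definition finished :: "nat \<Rightarrow> real \<Rightarrow> nat set" where
  "finished n t = {j \<in> {1..n}. C j \<le> t}"

lemma finite_finished [simp]: "finite (finished n t)"
  by (simp add: finished_def)

lemma finished_Suc:
  "finished (Suc n) t = (if C (Suc n) \<le> t then insert (Suc n) (finished n t) else finished n t)"
  by (auto simp: finished_def le_Suc_eq)

lemma card_finished_Suc: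
  "card (finished (Suc n) t) = card (finished n t) + (if C (Suc n) \<le> t then 1 else 0)"
proof -
  have "Suc n \<notin> finished n t" by (simp add: finished_def)
  then show ?thesis by (simp add: finished_Suc)
qed

lemma start_le_completion: "k \<ge> 1 \<Longrightarrow> S k \<le> C k"
  using service_pos[of k] by (simp add: completion_def)

text \<open>
  At most \<open>m - 1\<close> busy servers among \<open>k - 1\<close> predecessors means at least \<open>k - m\<close> finished ones; for
  \<open>k \<le> m\<close> the truncated difference is \<open>0\<close> and the condition is void, as it should be.
\<close>

lemma start_le_iff:
  assumes "k \<ge> 1"
  shows "S k \<le> t \<longleftrightarrow> arrival \<alpha> (int k) \<le> t \<and> k - m \<le> card (finished (k - 1) t)"
  using assms
proof (induction k arbitrary: t rule: less_induct)
  case (less k)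
  define n where "n = k - 1"
  have k: "k = Suc n" using less.prems by (simp add: n_def)
  have busy: "card {j. j \<in> {1..<k} \<and> S j + \<tau> j > t} \<le> m - 1 \<longleftrightarrow> k - m \<le> card (finished n t)" for t
  proof -
    let ?B = "{j. j \<in> {1..<k} \<and> S j + \<tau> j > t}"
    have "{1..n} = ?B \<union> finished n t" "?B \<inter> finished n t = {}"
      by (auto simp: finished_def completion_def k)
    then have "n = card ?B + card (finished n t)"
      using card_Un_disjoint[of ?B "finished n t"] finite_finished[of n t]
      by (metis card_atLeastAtMost diff_Suc_1 finite_Un finite_atLeastAtMost)
    then show ?thesis using servers k by auto
  qed
  have predecessor: "S n \<le> t"
    if "2 \<le> k" "arrival \<alpha> (int k) \<le> t" "k - m \<le> card (finished n t)" for t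
  proof -
    obtain i where i: "n = Suc i" using \<open>2 \<le> k\<close> k by (cases n) auto
    have "arrival \<alpha> (int n) \<le> arrival \<alpha> (int k)"
      using interarrival_nonneg[of k] unfolding k arrival_Suc by simp
    moreover have "n - m \<le> card (finished (n - 1) t)"
      using that(3) card_finished_Suc[of i t] by (auto simp: k i split: if_splits)
    ultimately show ?thesis using less.IH[of n t] that(2) i k by simp
  qed
  let ?R = "\<lambda>t. arrival \<alpha> (int k) \<le> t \<and> k - m \<le> card (finished n t)"
  have "S k = (LEAST t. ?R t)"
    unfolding service_start.simps[of m \<alpha> \<tau> k]
    using predecessor n_def busy by (intro arg_cong[where f = Least] ext) auto
  moreover obtain d where d: "\<And>t. ?R t \<longleftrightarrow> d \<le> t"
  proof (cases "k \<le> m")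
    case True
    then show ?thesis using that[of "arrival \<alpha> (int k)"] by simp
  next
    case False
    have "1 \<le> k - m" "k - m \<le> card {1..n}" using False servers k by auto
    then obtain e where "\<And>t. k - m \<le> card {j \<in> {1..n}. C j \<le> t} \<longleftrightarrow> e \<le> t"
      using ex_kth_smallest[of "{1..n}" "k - m" C] by auto
    then show ?thesis using that[of "max (arrival \<alpha> (int k)) e"] by (simp add: finished_def)
  qed
  ultimately show ?case
    using Least_eq_if_iff_ge[of ?R d] n_def by simp
qed

lemma start_mono:
  assumes "1 \<le> i" "i \<le> j"
  shows "S i \<le> S j"
  using assms(2)
proof (induction j rule: dec_induct)
  case (step j)
  have "arrival \<alpha> (int j) \<le> arrival \<alpha> (int (Suc j))"
    using interarrival_nonneg[of "Suc j"] by (simp only: arrival_Suc) simp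
  moreover have "Suc j - m \<le> card (finished j (S (Suc j)))"
      "arrival \<alpha> (int (Suc j)) \<le> S (Suc j)"
    using start_le_iff[of "Suc j" "S (Suc j)"] by auto
  moreover have "card (finished j t) \<le> Suc (card (finished (j - 1) t))" for t
    using card_finished_Suc[of "j - 1" t] step assms(1) by simp
  ultimately have "S j \<le> S (Suc j)"
    using start_le_iff[of j "S (Suc j)"] step assms(1)
      \<open>\<And>t. card (finished j t) \<le> Suc (card (finished (j - 1) t))\<close>[of "S (Suc j)"] by linarith
  then show ?case using step by simp
qed simp

text \<open>
  Late customers are handled by the order of service: if a customer numbered \<open>k + m\<close> or later
  is among the finished ones, then customer \<open>k + m\<close> has begun service, which already requires
  \<open>k\<close> completions among his predecessors.
\<close>

lemma departure_le_iff:
  assumes "k \<ge> 1"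
  shows "D (int k) \<le> t \<longleftrightarrow> k \<le> card (finished (k + m - 1) t)"
proof -
  let ?P = "\<lambda>t. \<exists>J \<subseteq> {j. 1 \<le> j \<and> C j \<le> t}. finite J \<and> card J = k"
  have iff: "?P t \<longleftrightarrow> k \<le> card (finished (k + m - 1) t)" for t
  proof
    assume "?P t"
    then obtain J where J: "J \<subseteq> {j. 1 \<le> j \<and> C j \<le> t}" "card J = k" by auto
    show "k \<le> card (finished (k + m - 1) t)"
    proof (cases "J \<subseteq> {1..k + m - 1}")
      case True
      then have "J \<subseteq> finished (k + m - 1) t" using J by (auto simp: finished_def)
      then show ?thesis using J card_mono finite_finished by metis
    next
      case False
      then obtain j where "j \<in> J" "j \<ge> k + m" using J by force
      then have "S (k + m) \<le> t"
        using start_mono[of "k + m" j] start_le_completion[of j] J assms by fastforce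
      then show ?thesis using start_le_iff[of "k + m" t] assms by simp
    qed
  next
    assume "k \<le> card (finished (k + m - 1) t)"
    then obtain J where "J \<subseteq> finished (k + m - 1) t" "card J = k" "finite J"
      using obtain_subset_with_card_n by metis
    then show "?P t" by (intro exI[of _ J]) (auto simp: finished_def)
  qed
  have "k \<le> card {1..k + m - 1}" using servers by simp
  then obtain d where d: "\<And>t. k \<le> card (finished (k + m - 1) t) \<longleftrightarrow> d \<le> t"
    using ex_kth_smallest[of "{1..k + m - 1}" k C] assms unfolding finished_def by blast
  have "D (int k) = (LEAST t. ?P t)" using assms by (simp add: departure_def)
  also have "\<dots> = d" using iff d by (intro Least_eq_if_iff_ge) simp
  finally show ?thesis using d by simp
qed

section \<open>The recursive equations\<close>

lemma start_eq_max:
  assumes "k \<ge> 1"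
  shows "S k = max (arrival \<alpha> (int k)) (D (int k - int m))"
proof -
  have "S k \<le> t \<longleftrightarrow> max (arrival \<alpha> (int k)) (D (int k - int m)) \<le> t" for t
  proof (cases "k \<le> m")
    case True
    have "0 \<le> arrival \<alpha> (int k)"
      unfolding arrival_def using interarrival_nonneg by (intro sum_nonneg) simp
    then show ?thesis using True start_le_iff[OF assms, of t] by (auto simp: departure_def)
  next
    case False
    then have "int k - int m = int (k - m)" "k - m + m - 1 = k - 1" by auto
    then show ?thesis using False start_le_iff[OF assms, of t] departure_le_iff[of "k - m" t] by simp
  qed
  then show ?thesis by (meson order_antisym order_refl)
qed

text \<open>
  Customer \<open>k + m - 1\<close> begins only after \<open>k - 1\<close> of his predecessors are finished. This is
  why his completion time need not be combined with those of \<open>k - 1\<close> others.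
\<close>

lemma departure_eq_min:
  assumes "k \<ge> 1"
  shows "ereal (D (int k)) =
    min (INF js \<in> increasing_tuples k (k + m - 2). ereal (Max (C ` set js)))
        (ereal (C (k + m - 1)))"
proof (rule ereal_eq_if_le_iff)
  fix t
  define n where "n = k + m - 2"
  have Suc_n: "k + m - 1 = Suc n" using assms servers by (simp add: n_def)
  have Max_le: "ereal (Max (C ` set js)) \<le> ereal t \<longleftrightarrow> (\<forall>j \<in> set js. C j \<le> t)"
    if "js \<in> increasing_tuples k n" for js
  proof -
    have "js \<noteq> []" using that assms by (auto simp: increasing_tuples_def)
    then show ?thesis by simp
  qed
  have "(INF js \<in> increasing_tuples k n. ereal (Max (C ` set js))) \<le> ereal t \<longleftrightarrow>
      (\<exists>js \<in> increasing_tuples k n. \<forall>j \<in> set js. C j \<le> t)"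
    using INF_finite_le_iff[OF finite_increasing_tuples] Max_le by simp
  also have "\<dots> \<longleftrightarrow> k \<le> card (finished n t)"
    by (simp add: ex_increasing_tuple_iff finished_def)
  finally have "min (INF js \<in> increasing_tuples k n. ereal (Max (C ` set js)))
      (ereal (C (Suc n))) \<le> ereal t \<longleftrightarrow> k \<le> card (finished n t) \<or> C (Suc n) \<le> t"
    by (simp add: min_le_iff_disj)
  also have "\<dots> \<longleftrightarrow> k \<le> card (finished (Suc n) t)"
  proof -
    have "k - 1 \<le> card (finished n t)" if "C (Suc n) \<le> t"
      using that start_le_completion[of "Suc n"] start_le_iff[of "Suc n" t] servers assms
      by (simp add: n_def)
    then show ?thesis using assms by (auto simp: card_finished_Suc)
  qed
  also have "\<dots> \<longleftrightarrow> D (int k) \<le> t" using departure_le_iff[OF assms] Suc_n by simp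
  finally show "min (INF js \<in> increasing_tuples k (k + m - 2). ereal (Max (C ` set js)))
      (ereal (C (k + m - 1))) \<le> ereal t \<longleftrightarrow> D (int k) \<le> t"
    unfolding Suc_n n_def .
qed

lemma queue_satisfies_recursion: "queue_recursion m \<alpha> \<tau> (arrival \<alpha>) C D"
proof -
  have "arrival \<alpha> (int k) = arrival \<alpha> (int k - 1) + \<alpha> k" if "k \<ge> 1" for k
    using arrival_Suc[of \<alpha> "k - 1"] that by (simp add: of_nat_diff)
  moreover have "C k = max (arrival \<alpha> (int k)) (D (int k - int m)) + \<tau> k" if "k \<ge> 1" for k
    using start_eq_max[OF that] by (simp add: completion_def)
  moreover have "arrival \<alpha> k = 0 \<and> D k = 0" if "k \<le> 0" for k
    using that by (simp add: arrival_def departure_def)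
  ultimately show ?thesis unfolding queue_recursion_def using departure_eq_min by simp
qed

end

section \<open>Uniqueness of the solution\<close>

text \<open>
  The induction runs over \<open>C\<close> alone: the equation for \<open>D i\<close> involves only \<open>C 1, \<dots>, C (i + m - 1)\<close>,
  so \<open>D (j - m)\<close> is fixed by the completion times before \<open>C j\<close>.
\<close>

lemma queue_recursion_unique:
  assumes m: "m \<ge> 1"
    and Q: "queue_recursion m \<alpha> \<tau> A C D" and Q': "queue_recursion m \<alpha> \<tau> A' C' D'"
  shows "A k = A' k" and "j \<ge> 1 \<Longrightarrow> C j = C' j" and "D k = D' k"
proof -
  have nonpos: "A i = A' i" "D i = D' i" if "i \<le> 0" for i
    using that Q Q' by (simp_all add: queue_recursion_def)
  have A_nat: "A (int n) = A' (int n)" for n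
  proof (induction n)
    case 0
    then show ?case using nonpos[of 0] by simp
  next
    case (Suc n)
    have "int (Suc n) - 1 = int n" "Suc n \<ge> 1" by simp_all
    then show ?case using Suc Q Q' unfolding queue_recursion_def by metis
  qed
  have D_cong: "D (int i) = D' (int i)"
    if i: "i \<ge> 1" and C: "\<And>j. 1 \<le> j \<Longrightarrow> j < i + m \<Longrightarrow> C j = C' j" for i
  proof -
    have "C ` set js = C' ` set js" if "js \<in> increasing_tuples i (i + m - 2)" for js
      using that i m by (intro image_cong C) (force simp: increasing_tuples_def)+
    then have "(INF js \<in> increasing_tuples i (i + m - 2). ereal (Max (C ` set js))) =
        (INF js \<in> increasing_tuples i (i + m - 2). ereal (Max (C' ` set js)))"
      by (intro INF_cong) auto
    moreover have "C (i + m - 1) = C' (i + m - 1)" using i m by (intro C) auto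
    ultimately have "ereal (D (int i)) = ereal (D' (int i))"
      using Q Q' i unfolding queue_recursion_def by metis
    then show ?thesis by simp
  qed
  have C_eq: "C j = C' j" if "j \<ge> 1" for j
    using that
  proof (induction j rule: less_induct)
    case (less j)
    have "D (int j - int m) = D' (int j - int m)"
    proof (cases "j \<le> m")
      case True
      then show ?thesis using nonpos by simp
    next
      case False
      then have "D (int (j - m)) = D' (int (j - m))" using less.IH by (intro D_cong) auto
      then show ?thesis using False by (simp add: of_nat_diff)
    qed
    then show ?case using less.prems Q Q' A_nat[of j] unfolding queue_recursion_def by metis
  qed
  show "A k = A' k" using nonpos(1)[of k] A_nat[of "nat k"] by (cases "k \<le> 0") auto
  show "j \<ge> 1 \<Longrightarrow> C j = C' j" by (rule C_eq)
  show "D k = D' k"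
    using nonpos(2)[of k] D_cong[of "nat k"] C_eq by (cases "k \<le> 0") auto
qed

theorem theorem3:
  fixes m :: nat and \<alpha> \<tau> :: "nat \<Rightarrow> real"
  assumes "m \<ge> 1"
    and "\<And>k. k \<ge> 1 \<Longrightarrow> \<alpha> k \<ge> 0"
    and "\<And>k. k \<ge> 1 \<Longrightarrow> \<tau> k > 0"
  shows "queue_recursion m \<alpha> \<tau> (arrival \<alpha>) (completion m \<alpha> \<tau>) (departure m \<alpha> \<tau>) \<and>
    (\<forall>A C D. queue_recursion m \<alpha> \<tau> A C D \<longrightarrow>
       (\<forall>k. A k = arrival \<alpha> k) \<and>
       (\<forall>k\<ge>1. C k = completion m \<alpha> \<tau> k) \<and>
       (\<forall>k. D k = departure m \<alpha> \<tau> k))"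
proof -
  interpret multi_server_queue m \<alpha> \<tau> using assms by unfold_locales
  show ?thesis
    using queue_satisfies_recursion queue_recursion_unique[OF assms(1) _ queue_satisfies_recursion]
    by blast
qed

end
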